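(* Let $\psi_\alpha(s_\alpha)$ and $\psi_\beta(s_\beta)$ be regular curves in Euclidean 3-space $\mathbf{E}^3$, parameterized by arclengths $s_\alpha$ and $s_\beta$, which are similar curves with variable transformation. Let $s_\alpha=s_\alpha(s_\beta)$ be the corresponding variable transformation of the arclengths, let $\mathbf{T}_\alpha$ be the unit tangent vector of $\psi_\alpha$, and let $\lambda^\beta_\alpha=\frac{ds_\beta}{ds_\alpha}$. Then the position vector of $\psi_\beta$ can be written in the form $$\psi_\beta(s_\beta)=\int \mathbf{T}_\alpha\big(s_\alpha(s_\beta)\big)\,ds_\beta=\int \mathbf{T}_\alpha(s_\alpha)\,\lambda^\beta_\alpha\,ds_\alpha .$$
   Context: Curves are in Euclidean 3-space $\mathbf{E}^3$ with the usual metric. Let $\psi_\alpha(s_\alpha)$ and $\psi_\beta(s_\beta)$ be two regular curves parameterized by arclengths $s_\alpha$ and $s_\beta$, with curvatures $\kappa_\alpha,\kappa_\beta$, torsions $\tau_\alpha,\tau_\beta$ and Frenet frames $\{\mathbf{T}_\alpha,\mathbf{N}_\alpha,\mathbf{B}_\alpha\}$ and $\{\mathbf{T}_\beta,\mathbf{N}_\beta,\mathbf{B}_\beta\}$ (unit tangent, principal normal, binormal). They are called similar curves with variable transformation $\lambda^\alpha_\beta$ if there exists a variable transformation $s_\alpha=\int\lambda^\alpha_\beta(s_\beta)\,ds_\beta$ of the arclengths, with $\lambda^\alpha_\beta$ an arbitrary function of the arclength, such that the tangent vectors are the same, $\mathbf{T}_\beta(s_\beta)=\mathbf{T}_\alpha(s_\alpha)$,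 for all corresponding values of the parameters under the transformation. Thus $\lambda^\alpha_\beta=\frac{ds_\alpha}{ds_\beta}$, $\lambda^\beta_\alpha=\frac{ds_\beta}{ds_\alpha}$ and $\lambda^\alpha_\beta\lambda^\beta_\alpha=1$. All curves satisfying this tangent equality are called a family of similar curves with variable transformations. Integrals are indefinite integrals, so the position vector is determined up to an additive constant vector. *)

theory Defs
  imports "HOL-Analysis.Analysis"
begin

type_synonym curve = "real \<Rightarrow> real ^ 3"

text \<open>
  Parameter domains are intervals with more than one point, with or without their end points;
  derivatives are taken within the domain, hence one-sided at an end point belonging to it.
\<close>

definition parameter_interval :: "real set \<Rightarrow> bool" where
  "parameter_interval I \<longleftrightarrow> is_interval I \<and> interior I \<noteq> {}"

definition velocity :: "real set \<Rightarrow> curve \<Rightarrow> curve" where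
  "velocity I \<psi> s = vector_derivative \<psi> (at s within I)"

definition regular_curve :: "real set \<Rightarrow> curve \<Rightarrow> bool" where
  "regular_curve I \<psi> \<longleftrightarrow>
     parameter_interval I \<and>
     (\<forall>s\<in>I. \<psi> differentiable (at s within I)) \<and>
     continuous_on I (velocity I \<psi>) \<and>
     (\<forall>s\<in>I. velocity I \<psi> s \<noteq> 0)"

definition arclength_curve :: "real set \<Rightarrow> curve \<Rightarrow> bool" where
  "arclength_curve I \<psi> \<longleftrightarrow> regular_curve I \<psi> \<and> (\<forall>s\<in>I. norm (velocity I \<psi> s) = 1)"

definition unit_tangent :: "real set \<Rightarrow> curve \<Rightarrow> curve" where
  "unit_tangent I \<psi> s = velocity I \<psi> s /\<^sub>R norm (velocity I \<psi> s)"

text \<open>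
  \<open>indefinite_integral I g F\<close> reads "\<open>F = \<integral> g\<close> on \<open>I\<close>". It is a relation because \<open>F\<close> is
  determined by \<open>g\<close> only up to an additive constant: \<open>F\<close> is a primitive of \<open>g\<close>, and
  its increments are the definite integrals of \<open>g\<close>.
\<close>

definition indefinite_integral ::
    "real set \<Rightarrow> (real \<Rightarrow> 'a::real_normed_vector) \<Rightarrow> (real \<Rightarrow> 'a) \<Rightarrow> bool" where
  "indefinite_integral I g F \<longleftrightarrow>
     (\<forall>s\<in>I. (F has_vector_derivative g s) (at s within I)) \<and>
     (\<forall>a\<in>I. \<forall>b\<in>I. a \<le> b \<longrightarrow> (g has_integral (F b - F a)) {a..b})"

text \<open>
  A variable transformation is a change of parameter \<open>f\<close> from \<open>J\<close> onto \<open>I\<close> with \<open>f = \<integral> l\<close>.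
  It is invertible with nowhere vanishing rate \<open>l\<close>, so that the rate of the inverse
  change of parameter exists and the product of the two rates is 1. The rate may be negative.
\<close>

definition variable_transformation ::
    "real set \<Rightarrow> real set \<Rightarrow> (real \<Rightarrow> real) \<Rightarrow> (real \<Rightarrow> real) \<Rightarrow> bool" where
  "variable_transformation J I f l \<longleftrightarrow>
     bij_betw f J I \<and> indefinite_integral J l f \<and> (\<forall>s\<in>J. l s \<noteq> 0)"

definition inverse_transformation :: "real set \<Rightarrow> (real \<Rightarrow> real) \<Rightarrow> real \<Rightarrow> real" where
  "inverse_transformation J f = inv_into J f"

definition inverse_rate :: "real set \<Rightarrow> real set \<Rightarrow> (real \<Rightarrow> real) \<Rightarrow> real \<Rightarrow> real" where
  "inverse_rate J I f u = vector_derivative (inverse_transformation J f) (at u within I)"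

text \<open>
  Similarity of \<open>\<psi>\<^sub>\<alpha>\<close> (on \<open>I\<close>) and \<open>\<psi>\<^sub>\<beta>\<close> (on \<open>J\<close>), witnessed by the variable transformation
  \<open>f\<close> with rate \<open>l\<close>; here \<open>f\<close> is \<open>s\<^sub>\<alpha>\<close> as a function of \<open>s\<^sub>\<beta>\<close> and \<open>l = ds\<^sub>\<alpha>/ds\<^sub>\<beta>\<close>.
\<close>

definition similar_curves_via ::
    "real set \<Rightarrow> curve \<Rightarrow> real set \<Rightarrow> curve \<Rightarrow> (real \<Rightarrow> real) \<Rightarrow> (real \<Rightarrow> real) \<Rightarrow> bool" where
  "similar_curves_via I \<psi>\<^sub>\<alpha> J \<psi>\<^sub>\<beta> f l \<longleftrightarrow>
     variable_transformation J I f l \<and>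
     (\<forall>s\<in>J. unit_tangent J \<psi>\<^sub>\<beta> s = unit_tangent I \<psi>\<^sub>\<alpha> (f s))"

end

theory Submission imports Defs
begin

text \<open>
  For a curve parameterized by arclength the velocity is the unit tangent, so similarity says
  exactly that \<open>\<psi>\<^sub>\<beta>\<close> is a primitive of \<open>T\<^sub>\<alpha> \<circ> s\<^sub>\<alpha>\<close>; this is the first formula. Substituting
  \<open>s\<^sub>\<beta> = s\<^sub>\<beta>(s\<^sub>\<alpha>)\<close> turns \<open>ds\<^sub>\<beta>\<close> into \<open>\<lambda>\<^sup>\<beta>\<^sub>\<alpha> ds\<^sub>\<alpha>\<close> by the chain rule; this is the second formula.

  In both formulas it is enough to differentiate: the gauge integral integrates every derivative
  back to its primitive (\<open>indefinite_integral_iff_primitive\<close>).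

  The substitution needs \<open>\<lambda>\<^sup>\<beta>\<^sub>\<alpha> = ds\<^sub>\<beta>/ds\<^sub>\<alpha>\<close> to exist. An injective continuous function on an
  interval is a homeomorphism onto its image, and a continuous inverse is differentiable wherever
  the derivative of the function is nonzero (\<open>has_vector_derivative_inverse_transformation\<close>). This
  derivative is the value of \<open>inverse_rate\<close>, because an interval with nonempty interior has no
  isolated points and so derivatives within it are unique.
\<close>

text \<open>
  The second clause in the definition of an indefinite integral follows from the first, by the
  fundamental theorem of calculus for the Henstock--Kurzweil integral, applied on each \<open>{a..b} \<subseteq> I\<close>.
\<close>

lemma indefinite_integral_iff_primitive:
  fixes F :: "real \<Rightarrow> 'a::banach"
  assumes "is_interval I"
  shows "indefinite_integral I g F \<longleftrightarrow> (\<forall>s\<in>I. (F has_vector_derivative g s) (at s within I))"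
proof
  assume primitive: "\<forall>s\<in>I. (F has_vector_derivative g s) (at s within I)"
  have "(g has_integral (F b - F a)) {a..b}" if "a \<in> I" "b \<in> I" "a \<le> b" for a b
  proof (rule fundamental_theorem_of_calculus[OF \<open>a \<le> b\<close>])
    have "{a..b} \<subseteq> I"
      using assms that by (meson atLeastAtMost_iff mem_is_interval_1_I subsetI)
    then show "(F has_vector_derivative g x) (at x within {a..b})" if "x \<in> {a..b}" for x
      using primitive that by (meson has_vector_derivative_within_subset subsetD)
  qed
  with primitive show "indefinite_integral I g F"
    by (simp add: indefinite_integral_def)
qed (simp add: indefinite_integral_def)

lemma parameter_interval_at_within_neq_bot:
  assumes "parameter_interval I" "s \<in> I"
  shows "at s within I \<noteq> bot"
proof -
  have "\<And>x. I \<noteq> {x}"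
    using assms by (auto simp: parameter_interval_def)
  moreover have "connected I"
    using assms by (simp add: parameter_interval_def is_interval_connected_1)
  ultimately have "s islimpt I"
    using assms connected_imp_perfect by blast
  then show ?thesis
    by (simp add: trivial_limit_within)
qed

lemma arclength_curve_has_unit_tangent:
  assumes "arclength_curve I \<psi>" "s \<in> I"
  shows "(\<psi> has_vector_derivative unit_tangent I \<psi> s) (at s within I)"
  using assms
  by (simp add: arclength_curve_def regular_curve_def unit_tangent_def velocity_def
      vector_derivative_works[symmetric])

lemma continuous_on_inverse_transformation:
  assumes "is_interval J" "continuous_on J f" "bij_betw f J I"
  shows "continuous_on I (inverse_transformation J f)"
proof -
  have "path_connected J"
    using assms by (simp add: is_interval_path_connected_1)
  then obtain g where g: "homeomorphism J I f g"
    using assms homeomorphism_into_1d[of J f I] by (auto simp: bij_betw_def)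
  have "inverse_transformation J f u = g u" if "u \<in> I" for u
    using g that assms unfolding inverse_transformation_def
    by (metis bij_betw_def homeomorphism_def image_eqI inv_into_f_f)
  then show ?thesis
    using g by (metis continuous_on_cong homeomorphism_def)
qed

text \<open>
  The inverse function rule within a set requires continuity of the inverse; on an interval this
  comes from the invertibility and continuity of \<open>f\<close>, so that \<open>l \<noteq> 0\<close> is all that is left to use.
  Since \<open>I = f ` J\<close>, the end points of \<open>I\<close> are covered as well, with one-sided derivatives.
\<close>

lemma has_vector_derivative_inverse_transformation:
  assumes transf: "variable_transformation J I f l" and "is_interval J" and "u \<in> I"
  shows "(inverse_transformation J f has_vector_derivative
            inverse (l (inverse_transformation J f u))) (at u within I)"
proof -
  define g where "g = inverse_transformation J f"
  have bij: "bij_betw f J I" and nonzero: "\<And>s. s \<in> J \<Longrightarrow> l s \<noteq> 0"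
    and deriv: "\<And>s. s \<in> J \<Longrightarrow> (f has_vector_derivative l s) (at s within J)"
    using transf by (auto simp: variable_transformation_def indefinite_integral_def)
  have image: "f ` J = I" and gf: "\<And>s. s \<in> J \<Longrightarrow> g (f s) = s"
    using bij by (auto simp: g_def inverse_transformation_def bij_betw_def)
  obtain s where s: "s \<in> J" "u = f s"
    using image \<open>u \<in> I\<close> by blast
  have "continuous_on J f"
    using deriv by (meson continuous_on_eq_continuous_within has_vector_derivative_continuous)
  then have "continuous_on I g"
    unfolding g_def using continuous_on_inverse_transformation[OF \<open>is_interval J\<close>] bij by blast
  then have cont: "continuous (at (f s) within f ` J) g"
    using \<open>u \<in> I\<close> s(2) image by (simp add: continuous_on_eq_continuous_within)
  have der: "(f has_derivative (\<lambda>h. h *\<^sub>R l s)) (at s within J)"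
    using deriv[OF s(1)] by (simp add: has_vector_derivative_def)
  have lin: "linear (\<lambda>h::real. h *\<^sub>R inverse (l s))"
    by (rule linear_scale_left)
  have inv: "(\<lambda>h. h *\<^sub>R inverse (l s)) \<circ> (\<lambda>h. h *\<^sub>R l s) = id"
    using nonzero[OF s(1)] by (auto simp: fun_eq_iff)
  have "(g has_derivative (\<lambda>h. h *\<^sub>R inverse (l s))) (at (f s) within f ` J)"
    by (rule has_derivative_inverse_within[OF der cont s(1) lin inv gf])
  then show ?thesis
    using gf[OF s(1)] unfolding g_def s(2) image has_vector_derivative_def by simp
qed

lemma inverse_rate_works:
  assumes "variable_transformation J I f l" "is_interval J" "parameter_interval I" "u \<in> I"
  shows "(inverse_transformation J f has_vector_derivative inverse_rate J I f u) (at u within I)"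
  using has_vector_derivative_inverse_transformation[OF assms(1,2,4)]
    vector_derivative_within[OF parameter_interval_at_within_neq_bot[OF assms(3,4)]]
  unfolding inverse_rate_def by metis

theorem theorem4p2:
  fixes \<psi>\<^sub>\<alpha> \<psi>\<^sub>\<beta> :: curve and I\<^sub>\<alpha> I\<^sub>\<beta> :: "real set" and s\<^sub>\<alpha> l\<^sub>\<alpha>\<^sub>\<beta> :: "real \<Rightarrow> real"
  assumes "arclength_curve I\<^sub>\<alpha> \<psi>\<^sub>\<alpha>"
    and "arclength_curve I\<^sub>\<beta> \<psi>\<^sub>\<beta>"
    and "similar_curves_via I\<^sub>\<alpha> \<psi>\<^sub>\<alpha> I\<^sub>\<beta> \<psi>\<^sub>\<beta> s\<^sub>\<alpha> l\<^sub>\<alpha>\<^sub>\<beta>"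
  shows "indefinite_integral I\<^sub>\<beta> (\<lambda>s. unit_tangent I\<^sub>\<alpha> \<psi>\<^sub>\<alpha> (s\<^sub>\<alpha> s)) \<psi>\<^sub>\<beta> \<and>
         indefinite_integral I\<^sub>\<alpha>
           (\<lambda>u. inverse_rate I\<^sub>\<beta> I\<^sub>\<alpha> s\<^sub>\<alpha> u *\<^sub>R unit_tangent I\<^sub>\<alpha> \<psi>\<^sub>\<alpha> u)
           (\<lambda>u. \<psi>\<^sub>\<beta> (inverse_transformation I\<^sub>\<beta> s\<^sub>\<alpha> u))"
proof -
  let ?T = "unit_tangent I\<^sub>\<alpha> \<psi>\<^sub>\<alpha>" and ?g = "inverse_transformation I\<^sub>\<beta> s\<^sub>\<alpha>"
  have transf: "variable_transformation I\<^sub>\<beta> I\<^sub>\<alpha> s\<^sub>\<alpha> l\<^sub>\<alpha>\<^sub>\<beta>"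
    and tangents: "\<And>s. s \<in> I\<^sub>\<beta> \<Longrightarrow> unit_tangent I\<^sub>\<beta> \<psi>\<^sub>\<beta> s = ?T (s\<^sub>\<alpha> s)"
    using assms(3) by (auto simp: similar_curves_via_def)
  have \<alpha>: "parameter_interval I\<^sub>\<alpha>" "is_interval I\<^sub>\<alpha>" and \<beta>: "is_interval I\<^sub>\<beta>"
    using assms(1,2) by (auto simp: arclength_curve_def regular_curve_def parameter_interval_def)
  have bij: "bij_betw s\<^sub>\<alpha> I\<^sub>\<beta> I\<^sub>\<alpha>"
    using transf by (simp add: variable_transformation_def)
  then have image: "?g ` I\<^sub>\<alpha> = I\<^sub>\<beta>" and right_inverse: "\<And>u. u \<in> I\<^sub>\<alpha> \<Longrightarrow> s\<^sub>\<alpha> (?g u) = u"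
    unfolding inverse_transformation_def
    by (auto simp: bij_betw_inv_into bij_betw_imp_surj_on bij_betw_inv_into_right)
  have deriv: "(\<psi>\<^sub>\<beta> has_vector_derivative ?T (s\<^sub>\<alpha> s)) (at s within I\<^sub>\<beta>)" if "s \<in> I\<^sub>\<beta>" for s
    using arclength_curve_has_unit_tangent[OF assms(2) that] tangents[OF that] by simp
  have "((\<lambda>u. \<psi>\<^sub>\<beta> (?g u)) has_vector_derivative inverse_rate I\<^sub>\<beta> I\<^sub>\<alpha> s\<^sub>\<alpha> u *\<^sub>R ?T u)
      (at u within I\<^sub>\<alpha>)" if "u \<in> I\<^sub>\<alpha>" for u
  proof -
    have "?g u \<in> I\<^sub>\<beta>"
      using image that by blast
    then have "(\<psi>\<^sub>\<beta> has_vector_derivative ?T u) (at (?g u) within ?g ` I\<^sub>\<alpha>)"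
      using deriv[of "?g u"] right_inverse[OF that] image by simp
    from vector_diff_chain_within[OF inverse_rate_works[OF transf \<beta> \<alpha>(1) that] this]
    show ?thesis
      by (simp add: o_def)
  qed
  with deriv show ?thesis
    using \<alpha>(2) \<beta> by (simp add: indefinite_integral_iff_primitive)
qed

end
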